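(* Let $X\subset\mathbb{P}_n$ be a Gorenstein projective subscheme of pure dimension $m\ge1$ and degree $d$, with characteristic sequence $(m_i)_{0\le i\le d-1}$, and let $Y\subset X$ be an ACM hypersurface of $X$ with relative characteristic sequence $(n_i)_{0\le i\le d-1}$. Let $s$ be the smallest degree of a hypersurface of $\mathbb{P}_n$ containing $Y$ and containing no component of $X$. Then $n_i\le s+m_i$ for all $i$. In particular, if $X$ is irreducible, then $n_i\le n_0+m_i$ for all $i$.
   Context: $k$ is an algebraically closed field of characteristic $0$, $A_n=k[X_0,\dots,X_n]$. A projective subscheme $X\subset\mathbb{P}_n$ is given by its saturated homogeneous ideal $I_X$; $A_X=A_n/I_X$ and $\phi_X(l)=\dim_k A_X(l)$. The components of $X$ are the subvarieties defined by the associated primes of $I_X$; "irreducible" means that $I_X$ is prime. $B[a](l)=B(a+l)$ denotes the shift of a graded module. $X$ of dimension $m$ is arithmetically Cohen-Macaulay (ACM) if $A_X$ admits a regular sequence of $m+1$ homogeneous polynomials. $X$ is Gorenstein (in the arithmetic sense) if it is ACM and the dualizing module satisfies $\omega_{A_X}\simeq A_X[a]$ for some integer $a$. Characteristic sequence: if $X$ is ACM of pure dimension $m$ and degree $d$, and $Y_0,\dots,Y_m$ are linear forms whose common zero locus does not meet $X$, put $R_m=k[Y_0,\dots,Y_m]$. Then $A_X\simeq\bigoplus_{i=0}^{d-1}R_m[-m_i]$ as graded $R_m$-modules with $0=m_0\le\dots\le m_{d-1}$; the sequence $(m_i)$ depends only on $\phi_X$ and is the characteristic sequence of $X$. Relative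 characteristic sequence: an ACM hypersurface of $X$ is an ACM closed subscheme $Y\subset X$ of pure dimension $m-1$. The kernel $I_{Y/X}=I_Y/I_X$ of $A_X\to A_Y$ is a graded free $R_m$-module of rank $d$, $I_{Y/X}\simeq\bigoplus_{i=0}^{d-1}R_m[-n_i]$ with $n_0\le\dots\le n_{d-1}$; $(n_i)$ is the relative characteristic sequence of $Y$ (relative to $X$). *)

theory Defs
  imports
    "HOL-Library.Poly_Mapping"
    "HOL-Library.Set_Algebras"
    "HOL-Library.Function_Algebras"
    "HOL-Computational_Algebra.Polynomial"
begin

section \<open>The graded polynomial ring\<close>

text \<open>The ring $A_n = k[X_0,\dots,X_n]$ is the whole type \<open>('v,'k) mpoly\<close>, where \<open>'v\<close> is a finite
  linearly ordered index type with $n + 1$ elements. A projective subscheme of $\mathbb{P}_n$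
  is represented by its saturated homogeneous ideal.\<close>

type_synonym ('v, 'k) mpoly = "('v \<Rightarrow>\<^sub>0 nat) \<Rightarrow>\<^sub>0 'k"

definition mdeg :: "('v::finite \<Rightarrow>\<^sub>0 nat) \<Rightarrow> nat"
  where "mdeg \<alpha> = (\<Sum>v\<in>UNIV. Poly_Mapping.lookup \<alpha> v)"

definition var :: "'v \<Rightarrow> ('v, 'k::field) mpoly"
  where "var v = Poly_Mapping.single (Poly_Mapping.single v 1) 1"

definition const :: "'k \<Rightarrow> ('v, 'k::field) mpoly"
  where "const c = Poly_Mapping.single 0 c"

definition eval_at :: "('v::finite \<Rightarrow> 'k) \<Rightarrow> ('v, 'k::field) mpoly \<Rightarrow> 'k"
  where "eval_at x p =
    (\<Sum>\<alpha>\<in>Poly_Mapping.keys p. Poly_Mapping.lookup p \<alpha> * (\<Prod>v\<in>UNIV. x v ^ Poly_Mapping.lookup \<alpha> v))"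

text \<open>The graded piece $A_n(l)$; it contains 0, and it is \<open>{0}\<close> for \<open>l < 0\<close>.\<close>

definition homog :: "int \<Rightarrow> ('v::finite, 'k::field) mpoly set"
  where "homog l = {p. \<forall>\<alpha>\<in>Poly_Mapping.keys p. int (mdeg \<alpha>) = l}"


section \<open>Ideals and projective subschemes\<close>

definition poly_ideal :: "('v, 'k::field) mpoly set \<Rightarrow> bool"
  where "poly_ideal I \<longleftrightarrow> module.subspace (*) I"

definition generated_ideal :: "('v, 'k::field) mpoly set \<Rightarrow> ('v, 'k) mpoly set"
  where "generated_ideal S = module.span (*) S"

definition prime_poly_ideal :: "('v, 'k::field) mpoly set \<Rightarrow> bool"
  where "prime_poly_ideal P \<longleftrightarrow>
    poly_ideal P \<and> P \<noteq> UNIV \<and> (\<forall>f g. f * g \<in> P \<longrightarrow> f \<in> P \<or> g \<in> P)"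

definition homogeneous_ideal :: "('v::finite, 'k::field) mpoly set \<Rightarrow> bool"
  where "homogeneous_ideal I \<longleftrightarrow>
    poly_ideal I \<and> generated_ideal (I \<inter> (\<Union>l. homog l)) = I"

definition saturated_ideal :: "('v::finite, 'k::field) mpoly set \<Rightarrow> bool"
  where "saturated_ideal I \<longleftrightarrow>
    (\<forall>f. (\<exists>r::nat. \<forall>g\<in>homog (int r). g * f \<in> I) \<longrightarrow> f \<in> I)"

definition projective_subscheme :: "('v::finite, 'k::field) mpoly set \<Rightarrow> bool"
  where "projective_subscheme I \<longleftrightarrow> homogeneous_ideal I \<and> saturated_ideal I"

definition associated_primes :: "('v, 'k::field) mpoly set \<Rightarrow> ('v, 'k) mpoly set set"
  where "associated_primes I = {P. prime_poly_ideal P \<and> (\<exists>a. P = {g. g * a \<in> I})}"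

text \<open>Dimension of the closed subscheme of $\mathbb{P}_n$ defined by \<open>I\<close>: the maximal length of a
  chain of irreducible closed subsets, that is, of a chain of homogeneous primes containing \<open>I\<close>,
  none of which is the irrelevant ideal. The empty subscheme has no dimension.\<close>

definition prime_chain :: "('v::finite, 'k::field) mpoly set \<Rightarrow> nat \<Rightarrow> bool"
  where "prime_chain I r \<longleftrightarrow> (\<exists>P :: nat \<Rightarrow> ('v, 'k) mpoly set.
    (\<forall>i\<le>r. prime_poly_ideal (P i) \<and> homogeneous_ideal (P i) \<and> I \<subseteq> P i \<and> (\<exists>v. var v \<notin> P i)) \<and>
    (\<forall>i<r. P i \<subset> P (Suc i)))"

definition has_dim :: "('v::finite, 'k::field) mpoly set \<Rightarrow> nat \<Rightarrow> bool"
  where "has_dim I m \<longleftrightarrow> prime_chain I m \<and> (\<forall>r. prime_chain I r \<longrightarrow> r \<le> m)"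

definition pure_dim :: "('v::finite, 'k::field) mpoly set \<Rightarrow> nat \<Rightarrow> bool"
  where "pure_dim I m \<longleftrightarrow> has_dim I m \<and> (\<forall>P\<in>associated_primes I. has_dim P m)"

text \<open>$\phi_X(l) = \dim_k A_X(l)$: the number of elements of any \<open>B\<close> whose residues form a
  \<open>k\<close>-basis of $A_X(l)$.\<close>

definition hilbert_function :: "('v::finite, 'k::field) mpoly set \<Rightarrow> int \<Rightarrow> nat"
  where "hilbert_function I l = (THE N. \<exists>B. B \<subseteq> homog l \<and> finite B \<and> card B = N \<and>
    (\<forall>f\<in>homog l. \<exists>!c :: ('v, 'k) mpoly \<Rightarrow> 'k.
       (\<forall>b. b \<notin> B \<longrightarrow> c b = 0) \<and> f - (\<Sum>b\<in>B. const (c b) * b) \<in> I))"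

text \<open>A subscheme of dimension \<open>m\<close> has degree \<open>d\<close> if its Hilbert polynomial has leading term
  $d\,l^m/m!$.\<close>

definition has_degree :: "('v::finite, 'k::field) mpoly set \<Rightarrow> nat \<Rightarrow> nat \<Rightarrow> bool"
  where "has_degree I m d \<longleftrightarrow> (\<exists>p :: rat poly. degree p = m \<and> lead_coeff p = of_nat d / fact m \<and>
    (\<exists>L. \<forall>l\<ge>L. of_nat (hilbert_function I (int l)) = poly p (of_nat l)))"

text \<open>\<open>fs\<close> is a regular sequence on $A_n/I$.\<close>

definition regular_sequence_mod ::
    "('v, 'k::field) mpoly set \<Rightarrow> ('v, 'k) mpoly list \<Rightarrow> bool"
  where "regular_sequence_mod I fs \<longleftrightarrow>
    generated_ideal (I \<union> set fs) \<noteq> UNIV \<and>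
    (\<forall>i<length fs. \<forall>g. g * fs ! i \<in> generated_ideal (I \<union> set (take i fs)) \<longrightarrow>
       g \<in> generated_ideal (I \<union> set (take i fs)))"

definition ACM :: "('v::finite, 'k::field) mpoly set \<Rightarrow> bool"
  where "ACM I \<longleftrightarrow> (\<exists>m fs. has_dim I m \<and> length fs = m + 1 \<and>
    (\<forall>f\<in>set fs. \<exists>l. f \<in> homog l) \<and> regular_sequence_mod I fs)"


section \<open>Graded modules\<close>

text \<open>The scalars are given separately, as a subset \<open>R\<close> of a ring type \<open>'p\<close>.\<close>

record ('p, 'b) graded_module =
  gcarrier :: "'b set"
  gadd :: "'b \<Rightarrow> 'b \<Rightarrow> 'b"
  gsmult :: "'p \<Rightarrow> 'b \<Rightarrow> 'b"
  gpiece :: "int \<Rightarrow> 'b set"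

definition graded_hom ::
    "'p set \<Rightarrow> ('p, 'b) graded_module \<Rightarrow> ('p, 'c) graded_module \<Rightarrow> ('b \<Rightarrow> 'c) \<Rightarrow> bool"
  where "graded_hom R M N \<phi> \<longleftrightarrow>
    (\<forall>x\<in>gcarrier M. \<phi> x \<in> gcarrier N) \<and>
    (\<forall>x\<in>gcarrier M. \<forall>y\<in>gcarrier M. \<phi> (gadd M x y) = gadd N (\<phi> x) (\<phi> y)) \<and>
    (\<forall>r\<in>R. \<forall>x\<in>gcarrier M. \<phi> (gsmult M r x) = gsmult N r (\<phi> x)) \<and>
    (\<forall>l. \<forall>x\<in>gpiece M l. \<phi> x \<in> gpiece N l)"

definition graded_iso ::
    "'p set \<Rightarrow> ('p, 'b) graded_module \<Rightarrow> ('p, 'c) graded_module \<Rightarrow> bool"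
  where "graded_iso R M N \<longleftrightarrow> (\<exists>\<phi>. graded_hom R M N \<phi> \<and>
    bij_betw \<phi> (gcarrier M) (gcarrier N) \<and> (\<forall>l. \<phi> ` gpiece M l = gpiece N l))"

text \<open>$M[a](l) = M(a+l)$.\<close>

definition gshift :: "int \<Rightarrow> ('p, 'b) graded_module \<Rightarrow> ('p, 'b) graded_module"
  where "gshift a M = M\<lparr>gpiece := (\<lambda>l. gpiece M (a + l))\<rparr>"

text \<open>The quotient \<open>N/D\<close>, with cosets as elements, of subgroups \<open>D \<subseteq> N\<close> of an ambient type with
  scalar multiplication \<open>sm\<close> and homogeneous elements \<open>pc l\<close> of degree \<open>l\<close>.\<close>

definition gquot ::
    "('p \<Rightarrow> 'b \<Rightarrow> 'b) \<Rightarrow> (int \<Rightarrow> 'b set) \<Rightarrow> 'b::ab_group_add set \<Rightarrow> 'b set \<Rightarrow> ('p, 'b set) graded_module"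
  where "gquot sm pc N D =
    \<lparr> gcarrier = (\<lambda>x. x +o D) ` N,
      gadd = (\<lambda>U V. U + V),
      gsmult = (\<lambda>r U. \<Union>x\<in>U. sm r x +o D),
      gpiece = (\<lambda>l. (\<lambda>x. x +o D) ` (N \<inter> pc l)) \<rparr>"

text \<open>$A_X = A_n/I_X$ and $I_{Y/X} = I_Y/I_X$.\<close>

definition coord_ring ::
    "('v::finite, 'k::field) mpoly set \<Rightarrow> (('v, 'k) mpoly, ('v, 'k) mpoly set) graded_module"
  where "coord_ring I = gquot (*) homog UNIV I"

definition relative_ideal ::
    "('v::finite, 'k::field) mpoly set \<Rightarrow> ('v, 'k) mpoly set \<Rightarrow>
     (('v, 'k) mpoly, ('v, 'k) mpoly set) graded_module"
  where "relative_ideal I J = gquot (*) homog J I"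

text \<open>$\bigoplus_{i<d} R[-a_i]$ for a graded subring \<open>R\<close> of $A_n$; the entries of index \<open>\<ge> d\<close> are
  fixed to 0.\<close>

definition gfree ::
    "('v::finite, 'k::field) mpoly set \<Rightarrow> nat \<Rightarrow> (nat \<Rightarrow> int) \<Rightarrow>
     (('v, 'k) mpoly, nat \<Rightarrow> ('v, 'k) mpoly) graded_module"
  where "gfree R d a =
    \<lparr> gcarrier = {x. (\<forall>i<d. x i \<in> R) \<and> (\<forall>i\<ge>d. x i = 0)},
      gadd = (\<lambda>x y i. x i + y i),
      gsmult = (\<lambda>r x i. r * x i),
      gpiece = (\<lambda>l. {x. (\<forall>i<d. x i \<in> R \<inter> homog (l - a i)) \<and> (\<forall>i\<ge>d. x i = 0)}) \<rparr>"


section \<open>The dualizing module and Gorenstein subschemes\<close>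

text \<open>A resolution $\dots \to F_1 \to F_0 \to A_X \to 0$ with maps \<open>\<delta> j\<close> from $F_{j+1}$ to $F_j$,
  where $F_j = \bigoplus_{i<r_j} A_n[-a_{j,i}]$.\<close>

definition graded_free_resolution ::
    "('v::finite, 'k::field) mpoly set \<Rightarrow> (nat \<Rightarrow> nat) \<Rightarrow> (nat \<Rightarrow> nat \<Rightarrow> int) \<Rightarrow>
     (nat \<Rightarrow> (nat \<Rightarrow> ('v, 'k) mpoly) \<Rightarrow> nat \<Rightarrow> ('v, 'k) mpoly) \<Rightarrow>
     ((nat \<Rightarrow> ('v, 'k) mpoly) \<Rightarrow> ('v, 'k) mpoly set) \<Rightarrow> bool"
  where "graded_free_resolution I rk a \<delta> \<epsilon> \<longleftrightarrow>
    (let F = (\<lambda>j. gfree UNIV (rk j) (a j)) in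
      graded_hom UNIV (F 0) (coord_ring I) \<epsilon> \<and>
      \<epsilon> ` gcarrier (F 0) = gcarrier (coord_ring I) \<and>
      (\<forall>j. graded_hom UNIV (F (Suc j)) (F j) (\<delta> j)) \<and>
      \<delta> 0 ` gcarrier (F 1) = {x \<in> gcarrier (F 0). \<epsilon> x = I} \<and>
      (\<forall>j. \<delta> (Suc j) ` gcarrier (F (Suc (Suc j))) = {x \<in> gcarrier (F (Suc j)). \<delta> j x = (\<lambda>_. 0)}))"

text \<open>$\mathrm{Hom}_{A_n}(F, A_n)$ for \<open>F\<close> = \<open>gfree UNIV d a\<close>; the maps are extended by 0
  outside the carrier. Since \<open>F\<close> is finitely generated, this is the sum of its graded pieces.
  The last definition is the piece of degree \<open>l\<close> of $\mathrm{Hom}_{A_n}(F, A_n[e])$.\<close>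

definition dual_carrier ::
    "nat \<Rightarrow> (nat \<Rightarrow> int) \<Rightarrow> ((nat \<Rightarrow> ('v::finite, 'k::field) mpoly) \<Rightarrow> ('v, 'k) mpoly) set"
  where "dual_carrier d a = (let F = gfree UNIV d a in
    {\<phi>. (\<forall>x\<in>gcarrier F. \<forall>y\<in>gcarrier F. \<phi> (gadd F x y) = \<phi> x + \<phi> y) \<and>
        (\<forall>r. \<forall>x\<in>gcarrier F. \<phi> (gsmult F r x) = r * \<phi> x) \<and>
        (\<forall>x. x \<notin> gcarrier F \<longrightarrow> \<phi> x = 0)})"

definition dual_piece ::
    "int \<Rightarrow> nat \<Rightarrow> (nat \<Rightarrow> int) \<Rightarrow> int \<Rightarrow>
     ((nat \<Rightarrow> ('v::finite, 'k::field) mpoly) \<Rightarrow> ('v, 'k) mpoly) set"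
  where "dual_piece e d a l =
    {\<phi> \<in> dual_carrier d a. \<forall>t. \<forall>x\<in>gpiece (gfree UNIV d a) t. \<phi> x \<in> homog (e + (t + l))}"

text \<open>$\mathrm{Ext}^c_{A_n}(A_X, A_n[e])$ computed from a graded free resolution of $A_X$.\<close>

definition ext_module ::
    "int \<Rightarrow> nat \<Rightarrow> (nat \<Rightarrow> nat) \<Rightarrow> (nat \<Rightarrow> nat \<Rightarrow> int) \<Rightarrow>
     (nat \<Rightarrow> (nat \<Rightarrow> ('v::finite, 'k::field) mpoly) \<Rightarrow> nat \<Rightarrow> ('v, 'k) mpoly) \<Rightarrow>
     (('v, 'k) mpoly, ((nat \<Rightarrow> ('v, 'k) mpoly) \<Rightarrow> ('v, 'k) mpoly) set) graded_module"
  where "ext_module e c rk a \<delta> =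
    (let F = (\<lambda>j. gfree UNIV (rk j) (a j));
         pullback = (\<lambda>j \<psi> x. if x \<in> gcarrier (F (Suc j)) then \<psi> (\<delta> j x) else 0);
         cocycles = {\<phi> \<in> dual_carrier (rk c) (a c). pullback c \<phi> = (\<lambda>_. 0)};
         coboundaries = (case c of 0 \<Rightarrow> {\<lambda>_. 0}
                         | Suc j \<Rightarrow> pullback j ` dual_carrier (rk j) (a j))
     in gquot (\<lambda>r \<phi> x. r * \<phi> x) (dual_piece e (rk c) (a c)) cocycles coboundaries)"

text \<open>$\omega_{A_X} = \mathrm{Ext}^{n-m}_{A_n}(A_X, A_n[-n-1])$ with \<open>m\<close> the dimension of \<open>X\<close>. It is
  determined up to graded isomorphism, since the resolution is not unique.\<close>

definition dualizing_module ::
    "('v::finite, 'k::field) mpoly set \<Rightarrow>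
     (('v, 'k) mpoly, ((nat \<Rightarrow> ('v, 'k) mpoly) \<Rightarrow> ('v, 'k) mpoly) set) graded_module \<Rightarrow> bool"
  where "dualizing_module I \<omega> \<longleftrightarrow> (\<exists>n m rk a \<delta> \<epsilon>.
    card (UNIV :: 'v set) = n + 1 \<and> has_dim I m \<and> graded_free_resolution I rk a \<delta> \<epsilon> \<and>
    \<omega> = ext_module (- int n - 1) (n - m) rk a \<delta>)"

definition gorenstein :: "('v::finite, 'k::field) mpoly set \<Rightarrow> bool"
  where "gorenstein I \<longleftrightarrow> ACM I \<and>
    (\<exists>\<omega> a. dualizing_module I \<omega> \<and> graded_iso UNIV \<omega> (gshift a (coord_ring I)))"


section \<open>Characteristic sequences\<close>

text \<open>Linear forms $Y_0,\dots,Y_m$ whose common zero locus in $\mathbb{P}_n$ does not meet \<open>X\<close>. As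
  \<open>k\<close> is algebraically closed, it is enough to consider \<open>k\<close>-rational points.\<close>

definition avoiding_forms ::
    "('v::finite, 'k::field) mpoly set \<Rightarrow> nat \<Rightarrow> (nat \<Rightarrow> ('v, 'k) mpoly) \<Rightarrow> bool"
  where "avoiding_forms I m y \<longleftrightarrow> (\<forall>i\<le>m. y i \<in> homog 1) \<and>
    \<not> (\<exists>x :: 'v \<Rightarrow> 'k. (\<exists>v. x v \<noteq> 0) \<and> (\<forall>f\<in>I. eval_at x f = 0) \<and> (\<forall>i\<le>m. eval_at x (y i) = 0))"

text \<open>The subring $R_m = k[Y_0,\dots,Y_m]$ of $A_n$.\<close>

inductive_set form_ring :: "nat \<Rightarrow> (nat \<Rightarrow> ('v, 'k::field) mpoly) \<Rightarrow> ('v, 'k) mpoly set"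
  for m y where
  const: "const c \<in> form_ring m y"
| form: "i \<le> m \<Longrightarrow> y i \<in> form_ring m y"
| add: "f \<in> form_ring m y \<Longrightarrow> g \<in> form_ring m y \<Longrightarrow> f + g \<in> form_ring m y"
| mult: "f \<in> form_ring m y \<Longrightarrow> g \<in> form_ring m y \<Longrightarrow> f * g \<in> form_ring m y"

text \<open>The sequences do not depend on the choice of the forms \<open>y\<close>, which are a parameter here so that
  both sequences refer to the same ring $R_m$.\<close>

definition characteristic_sequence ::
    "('v::finite, 'k::field) mpoly set \<Rightarrow> nat \<Rightarrow> (nat \<Rightarrow> ('v, 'k) mpoly) \<Rightarrow> nat \<Rightarrow> (nat \<Rightarrow> nat) \<Rightarrow> bool"
  where "characteristic_sequence I m y d ms \<longleftrightarrow>
    ms 0 = 0 \<and> mono_on {..<d} ms \<and>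
    graded_iso (form_ring m y) (coord_ring I) (gfree (form_ring m y) d (\<lambda>i. int (ms i)))"

definition acm_hypersurface ::
    "('v::finite, 'k::field) mpoly set \<Rightarrow> nat \<Rightarrow> ('v, 'k) mpoly set \<Rightarrow> bool"
  where "acm_hypersurface I m J \<longleftrightarrow>
    projective_subscheme J \<and> I \<subseteq> J \<and> ACM J \<and> pure_dim J (m - 1)"

definition relative_characteristic_sequence ::
    "('v::finite, 'k::field) mpoly set \<Rightarrow> ('v, 'k) mpoly set \<Rightarrow> nat \<Rightarrow> (nat \<Rightarrow> ('v, 'k) mpoly) \<Rightarrow>
     nat \<Rightarrow> (nat \<Rightarrow> nat) \<Rightarrow> bool"
  where "relative_characteristic_sequence I J m y d ns \<longleftrightarrow>
    mono_on {..<d} ns \<and>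
    graded_iso (form_ring m y) (relative_ideal I J) (gfree (form_ring m y) d (\<lambda>i. int (ns i)))"

text \<open>The smallest degree of a hypersurface $F = 0$ of $\mathbb{P}_n$ that contains \<open>Y\<close> and contains
  no component of \<open>X\<close>: the hypersurface contains the component with prime \<open>P\<close> iff \<open>F \<in> P\<close>.\<close>

definition smallest_hypersurface_degree ::
    "('v::finite, 'k::field) mpoly set \<Rightarrow> ('v, 'k) mpoly set \<Rightarrow> nat"
  where "smallest_hypersurface_degree I J = (LEAST s. \<exists>F\<in>homog (int s). F \<noteq> 0 \<and> F \<in> J \<and>
    (\<forall>P\<in>associated_primes I. F \<notin> P))"

end

theory Submission
  imports Defs
begin

text \<open>A homogeneous \<open>F \<in> I\<^sub>Y\<close> of degree $s$ outside the associated primes of \<open>I\<^sub>X\<close> is a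
  nonzerodivisor on $A_X$, so multiplication by \<open>F\<close> embeds the free $R_m$-module $A_X[-s]$ into
  the free $R_m$-module $I_{Y/X}$ of the same rank. If $n_i > s + m_i$, then for degree reasons the
  first $i+1$ basis elements are mapped into the span of the first $i$ basis elements, which has
  rank $i$. Such an \<open>F\<close> exists because a rank count shows $I_Y \cap R_m \neq 0$, and $R_m$ acts
  without torsion on $A_X$.\<close>

section \<open>Linear algebra over a subring of a domain\<close>

text \<open>A locale on sets rather than a type, because $R_m$ is given as a subset of the
  polynomial type.\<close>

locale subring_set =
  fixes R :: "'a::comm_ring_1 set"
  assumes one_mem: "1 \<in> R"
    and add_mem: "a \<in> R \<Longrightarrow> b \<in> R \<Longrightarrow> a + b \<in> R"
    and mult_mem: "a \<in> R \<Longrightarrow> b \<in> R \<Longrightarrow> a * b \<in> R"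
    and uminus_mem: "a \<in> R \<Longrightarrow> - a \<in> R"
begin

lemma zero_mem: "0 \<in> R"
  using add_mem[OF one_mem uminus_mem[OF one_mem]] by simp

lemma diff_mem: "a \<in> R \<Longrightarrow> b \<in> R \<Longrightarrow> a - b \<in> R"
  using add_mem[of a "- b"] uminus_mem by simp

lemma sum_mem: "(\<And>x. x \<in> A \<Longrightarrow> f x \<in> R) \<Longrightarrow> sum f A \<in> R"
  by (induction A rule: infinite_finite_induct) (auto intro: zero_mem add_mem)

end

text \<open>Gaussian elimination by cross-multiplication, one coordinate at a time; the coefficients
  stay in \<open>R\<close> instead of its fraction field.\<close>

lemma exists_linear_relation:
  fixes R :: "'a::idom set" and w :: "'i \<Rightarrow> nat \<Rightarrow> 'a"
  assumes "subring_set R" and "finite A" "n < card A" "\<And>j t. j \<in> A \<Longrightarrow> t < n \<Longrightarrow> w j t \<in> R"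
  shows "\<exists>c. (\<forall>j\<in>A. c j \<in> R) \<and> (\<exists>j\<in>A. c j \<noteq> 0) \<and> (\<forall>t<n. (\<Sum>j\<in>A. c j * w j t) = 0)"
proof -
  interpret subring_set R by fact
  show ?thesis using assms(2-4)
  proof (induction n arbitrary: A w)
    case 0
    then have "A \<noteq> {}" by auto
    then show ?case by (intro exI[of _ "\<lambda>_. 1"]) (auto intro: one_mem)
  next
    case (Suc n)
    show ?case
    proof (cases "\<forall>j\<in>A. w j n = 0")
      case True
      have "\<exists>c. (\<forall>j\<in>A. c j \<in> R) \<and> (\<exists>j\<in>A. c j \<noteq> 0) \<and> (\<forall>t<n. (\<Sum>j\<in>A. c j * w j t) = 0)"
        using Suc.prems by (intro Suc.IH) auto
      with True show ?thesis by (auto simp: less_Suc_eq)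
    next
      case False
      then obtain p where p: "p \<in> A" "w p n \<noteq> 0" by blast
      \<comment> \<open>The pivot vector \<open>w p\<close> clears coordinate \<open>n\<close>:
        \<open>w' j n = 0\<close> for all \<open>j\<close>.\<close>
      define w' where "w' j t = w p n * w j t - w j n * w p t" for j t
      have wR: "w j t \<in> R" if "j \<in> A" "t \<le> n" for j t
        using Suc.prems(3) that by simp
      have "\<exists>c. (\<forall>j\<in>A - {p}. c j \<in> R) \<and> (\<exists>j\<in>A - {p}. c j \<noteq> 0) \<and>
          (\<forall>t<n. (\<Sum>j\<in>A - {p}. c j * w' j t) = 0)"
        using Suc.prems p by (intro Suc.IH) (auto simp: w'_def intro!: diff_mem mult_mem)
      then obtain c where c: "\<forall>j\<in>A - {p}. c j \<in> R" "\<exists>j\<in>A - {p}. c j \<noteq> 0"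
          "\<forall>t<n. (\<Sum>j\<in>A - {p}. c j * w' j t) = 0" by blast
      \<comment> \<open>Expanding the relation for \<open>w'\<close> and collecting the multiples of
        \<open>w p\<close> gives these coefficients. Away from \<open>p\<close> they are only scaled
        by the nonzero pivot, so a nonzero one survives.\<close>
      define c' where "c' j = (if j = p then - (\<Sum>j\<in>A - {p}. c j * w j n) else w p n * c j)" for j
      have eq: "(\<Sum>j\<in>A. c' j * w j t) = (\<Sum>j\<in>A - {p}. c j * w' j t)" for t
      proof -
        have "(\<Sum>j\<in>A. c' j * w j t) = c' p * w p t + (\<Sum>j\<in>A - {p}. c' j * w j t)"
          using Suc.prems(1) p(1) by (simp add: sum.remove)
        also have "\<dots> = (\<Sum>j\<in>A - {p}. c' j * w j t - c j * w j n * w p t)"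
          by (simp add: c'_def sum_subtractf sum_distrib_right)
        also have "\<dots> = (\<Sum>j\<in>A - {p}. c j * w' j t)"
          by (intro sum.cong) (auto simp: c'_def w'_def algebra_simps)
        finally show ?thesis .
      qed
      have "\<forall>j\<in>A. c' j \<in> R"
        using c(1) p wR by (auto simp: c'_def intro!: uminus_mem sum_mem mult_mem)
      moreover obtain q where "q \<in> A - {p}" "c q \<noteq> 0" using c(2) by blast
      then have "\<exists>j\<in>A. c' j \<noteq> 0"
        using p(2) by (intro bexI[of _ q]) (auto simp: c'_def)
      moreover have "(\<Sum>j\<in>A. c' j * w j t) = 0" if "t < Suc n" for t
        using that c(3) by (cases "t = n") (auto simp: eq w'_def mult.commute less_Suc_eq)
      ultimately show ?thesis by blast
    qed
  qed
qed

text \<open>Linear independence over \<open>R\<close> of the residues of \<open>e 0\<close>, ...,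
  \<open>e (n - 1)\<close> modulo \<open>I\<close>. No coordinates enter, so a family in $I_Y$ can
  be tested inside $A_X$ as well.\<close>

definition independent_mod :: "'a::comm_ring_1 set \<Rightarrow> 'a set \<Rightarrow> nat \<Rightarrow> (nat \<Rightarrow> 'a) \<Rightarrow> bool"
  where "independent_mod R I n e \<longleftrightarrow>
    (\<forall>c. (\<forall>j<n. c j \<in> R) \<and> (\<Sum>j<n. c j * e j) \<in> I \<longrightarrow> (\<forall>j<n. c j = 0))"


section \<open>Ideals and homogeneous components\<close>

lemma module_mult: "module ((*) :: 'a::comm_ring_1 \<Rightarrow> 'a \<Rightarrow> 'a)"
  by unfold_locales (simp_all add: algebra_simps)

lemma poly_ideal_iff:
  "poly_ideal I \<longleftrightarrow> 0 \<in> I \<and> (\<forall>x\<in>I. \<forall>y\<in>I. x + y \<in> I) \<and> (\<forall>c. \<forall>x\<in>I. c * x \<in> I)"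
  by (simp add: poly_ideal_def module.subspace_def[OF module_mult])

lemma
  assumes "poly_ideal I"
  shows poly_ideal_zero: "0 \<in> I"
    and poly_ideal_add: "x \<in> I \<Longrightarrow> y \<in> I \<Longrightarrow> x + y \<in> I"
    and poly_ideal_mult: "x \<in> I \<Longrightarrow> c * x \<in> I"
    and poly_ideal_uminus: "x \<in> I \<Longrightarrow> - x \<in> I"
    and poly_ideal_diff: "x \<in> I \<Longrightarrow> y \<in> I \<Longrightarrow> x - y \<in> I"
    and poly_ideal_sum: "(\<And>j. j \<in> A \<Longrightarrow> f j \<in> I) \<Longrightarrow> sum f A \<in> I"
proof -
  note s = assms[unfolded poly_ideal_def]
  show "0 \<in> I" using module.subspace_0[OF module_mult s] .
  show "x \<in> I \<Longrightarrow> y \<in> I \<Longrightarrow> x + y \<in> I" using module.subspace_add[OF module_mult s] .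
  show "x \<in> I \<Longrightarrow> c * x \<in> I" using module.subspace_scale[OF module_mult s] .
  show "x \<in> I \<Longrightarrow> - x \<in> I" using module.subspace_neg[OF module_mult s] .
  show "x \<in> I \<Longrightarrow> y \<in> I \<Longrightarrow> x - y \<in> I" using module.subspace_diff[OF module_mult s] .
  show "(\<And>j. j \<in> A \<Longrightarrow> f j \<in> I) \<Longrightarrow> sum f A \<in> I"
    using module.subspace_sum[OF module_mult s] .
qed

section \<open>Cosets of an ideal\<close>

lemma coset_eq_iff:
  assumes "poly_ideal I"
  shows "x +o I = y +o I \<longleftrightarrow> x - y \<in> I"
proof
  assume "x +o I = y +o I"
  moreover have "x \<in> x +o I"
    using poly_ideal_zero[OF assms] unfolding elt_set_plus_def by force
  ultimately show "x - y \<in> I" unfolding elt_set_plus_def by force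
next
  have sub: "u +o I \<subseteq> v +o I" if "u - v \<in> I" for u v
  proof
    fix z assume "z \<in> u +o I"
    then obtain b where "b \<in> I" "z = u + b" by (auto simp: elt_set_plus_def)
    then have "z = v + ((u - v) + b)" "(u - v) + b \<in> I"
      using poly_ideal_add[OF assms] that by auto
    then show "z \<in> v +o I" unfolding elt_set_plus_def by blast
  qed
  assume "x - y \<in> I"
  moreover from this have "y - x \<in> I" using poly_ideal_uminus[OF assms, of "x - y"] by simp
  ultimately show "x +o I = y +o I" using sub by blast
qed

lemma coset_add:
  assumes "poly_ideal I"
  shows "(x +o I) + (y +o I) = (x + y) +o I"
proof -
  have "I + I = I"
    using poly_ideal_add[OF assms] poly_ideal_zero[OF assms] by (force simp: set_plus_def)
  then show ?thesis by (simp add: set_plus_rearrange)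
qed

text \<open>All sets in the union coincide, since \<open>r\<close> maps \<open>I\<close> into
  itself; thus \<open>gsmult\<close> in \<open>gquot\<close> is the usual multiplication of
  cosets.\<close>

lemma coset_mult:
  assumes "poly_ideal I"
  shows "(\<Union>u\<in>x +o I. r * u +o I) = (r * x) +o I"
proof -
  have "r * u +o I = (r * x) +o I" if "u \<in> x +o I" for u
  proof -
    from that obtain b where "b \<in> I" "u = x + b" by (auto simp: elt_set_plus_def)
    then show ?thesis
      using poly_ideal_mult[OF assms] by (simp add: coset_eq_iff[OF assms] algebra_simps)
  qed
  moreover have "x \<in> x +o I"
    using poly_ideal_zero[OF assms] unfolding elt_set_plus_def by force
  ultimately show ?thesis by blast
qed

section \<open>Degrees and homogeneous components\<close>

lemma mdeg_add: "mdeg (\<alpha> + \<beta>) = mdeg \<alpha> + mdeg \<beta>"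
  by (simp add: mdeg_def lookup_add sum.distrib)

lemma homog_mult: "p \<in> homog a \<Longrightarrow> q \<in> homog b \<Longrightarrow> p * q \<in> homog (a + b)"
  using keys_mult[of p q] by (fastforce simp: homog_def mdeg_add)

lemma homog_negative:
  assumes "p \<in> homog l" "l < 0"
  shows "p = 0"
proof -
  have "Poly_Mapping.keys p = {}" using assms by (force simp: homog_def)
  then show ?thesis by simp
qed

definition hcomp :: "int \<Rightarrow> ('v::finite, 'k::field) mpoly \<Rightarrow> ('v, 'k) mpoly"
  where "hcomp l p = (\<Sum>\<alpha> | \<alpha> \<in> Poly_Mapping.keys p \<and> int (mdeg \<alpha>) = l.
    Poly_Mapping.single \<alpha> (Poly_Mapping.lookup p \<alpha>))"

lemma lookup_hcomp:
  "Poly_Mapping.lookup (hcomp l p) \<beta> = (if int (mdeg \<beta>) = l then Poly_Mapping.lookup p \<beta> else 0)"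
proof -
  have "Poly_Mapping.lookup (hcomp l p) \<beta> =
      (\<Sum>\<alpha> | \<alpha> \<in> Poly_Mapping.keys p \<and> int (mdeg \<alpha>) = l.
        if \<alpha> = \<beta> then Poly_Mapping.lookup p \<alpha> else 0)"
    by (simp add: hcomp_def lookup_sum lookup_single when_def)
  also have "\<dots> = (if int (mdeg \<beta>) = l then Poly_Mapping.lookup p \<beta> else 0)"
    by (simp add: in_keys_iff)
  finally show ?thesis .
qed

lemma hcomp_add: "hcomp l (p + q) = hcomp l p + hcomp l q"
  by (intro poly_mapping_eqI) (simp add: lookup_hcomp lookup_add)

lemma hcomp_zero: "hcomp l 0 = 0"
  by (intro poly_mapping_eqI) (simp add: lookup_hcomp)

lemma hcomp_sum: "hcomp l (sum f A) = (\<Sum>a\<in>A. hcomp l (f a))"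
  by (induction A rule: infinite_finite_induct) (simp_all add: hcomp_add hcomp_zero)

lemma hcomp_in_homog: "hcomp l p \<in> homog l"
  by (auto simp: homog_def in_keys_iff lookup_hcomp split: if_splits)

lemma hcomp_homog:
  assumes "p \<in> homog e"
  shows "hcomp l p = (if l = e then p else 0)"
proof (rule poly_mapping_eqI)
  fix \<beta>
  have "Poly_Mapping.lookup p \<beta> = 0" if "int (mdeg \<beta>) \<noteq> e"
    using assms that by (auto simp: homog_def in_keys_iff)
  then show "Poly_Mapping.lookup (hcomp l p) \<beta> = Poly_Mapping.lookup (if l = e then p else 0) \<beta>"
    by (auto simp: lookup_hcomp)
qed

lemma sum_hcomp: "p = (\<Sum>l\<in>(int \<circ> mdeg) ` Poly_Mapping.keys p. hcomp l p)"
proof (rule poly_mapping_eqI)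
  fix \<beta>
  show "Poly_Mapping.lookup p \<beta> =
      Poly_Mapping.lookup (\<Sum>l\<in>(int \<circ> mdeg) ` Poly_Mapping.keys p. hcomp l p) \<beta>"
    by (auto simp: lookup_sum lookup_hcomp in_keys_iff)
qed

lemma hcomp_nonzero:
  assumes "p \<noteq> 0"
  obtains l where "hcomp l p \<noteq> 0"
  using assms sum_hcomp[of p] by (metis sum.neutral)

text \<open>Decompose \<open>p\<close>: the products of its components with \<open>q\<close> lie in
  distinct degrees, and just one of them has degree \<open>l\<close>.\<close>

lemma hcomp_mult_homog:
  assumes "q \<in> homog e"
  shows "hcomp l (p * q) = hcomp (l - e) p * q"
proof -
  let ?D = "(int \<circ> mdeg) ` Poly_Mapping.keys p"
  have "hcomp l (p * q) = hcomp l (\<Sum>a\<in>?D. hcomp a p * q)"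
    by (subst sum_hcomp[of p]) (simp add: sum_distrib_right)
  also have "\<dots> = (\<Sum>a\<in>?D. if a = l - e then hcomp a p * q else 0)"
    unfolding hcomp_sum
  proof (rule sum.cong[OF refl])
    fix a
    show "hcomp l (hcomp a p * q) = (if a = l - e then hcomp a p * q else 0)"
      using hcomp_homog[OF homog_mult[OF hcomp_in_homog assms], of l a p] by auto
  qed
  also have "\<dots> = hcomp (l - e) p * q"
  \<comment> \<open>If \<open>p\<close> has no monomial of degree \<open>l - e\<close>, both sides
    are 0.\<close>
  proof (cases "l - e \<in> ?D")
    case False
    then have "hcomp (l - e) p = 0"
      by (intro poly_mapping_eqI) (auto simp: lookup_hcomp image_iff, metis in_keys_iff)
    with False show ?thesis by simp
  qed simp
  finally show ?thesis .
qed

text \<open>For a homogeneous generator \<open>x\<close>, the components of \<open>c * x\<close> are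
  again multiples of \<open>x\<close>; induction over the span does the rest.\<close>

lemma homogeneous_ideal_hcomp:
  assumes "homogeneous_ideal J" "f \<in> J"
  shows "hcomp l f \<in> J"
proof -
  have J: "poly_ideal J" and gen: "module.span (*) (J \<inter> (\<Union>l. homog l)) = J"
    using assms(1) by (auto simp: homogeneous_ideal_def generated_ideal_def)
  have "f \<in> module.span (*) (J \<inter> (\<Union>l. homog l))" using gen assms(2) by simp
  then show ?thesis
  proof (induction rule: module.span_induct_alt[OF module_mult, consumes 1, case_names base step])
    case base
    show ?case using poly_ideal_zero[OF J] by (simp add: hcomp_zero)
  next
    case (step c x z)
    then obtain e where "x \<in> J" "x \<in> homog e" by blast
    with step show ?case
      using poly_ideal_add[OF J] poly_ideal_mult[OF J] by (simp add: hcomp_add hcomp_mult_homog)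
  qed
qed

section \<open>$R_m$ as a graded subring\<close>

lemma subring_set_form_ring: "subring_set (form_ring m y)"
proof
  show "1 \<in> form_ring m y"
    using form_ring.const[of 1] by (simp add: const_def single_one)
  show "- a \<in> form_ring m y" if "a \<in> form_ring m y" for a
  proof -
    have "const (- 1) * a = - a"
      by (simp add: const_def single_uminus single_one)
    then show ?thesis using form_ring.mult[OF form_ring.const that, of "- 1"] by simp
  qed
qed (auto intro: form_ring.intros)

text \<open>$R_m$ is generated by homogeneous elements. This allows replacing an element of $I_Y$ in
  $R_m$ by one of its components.\<close>

lemma form_ring_hcomp:
  fixes y :: "nat \<Rightarrow> ('v::finite, 'k::field) mpoly"
  assumes "\<forall>i\<le>m. y i \<in> homog 1" "f \<in> form_ring m y"
  shows "hcomp l f \<in> form_ring m y"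
proof -
  interpret subring_set "form_ring m y" by (rule subring_set_form_ring)
  show ?thesis using assms(2)
  proof (induction arbitrary: l)
    case (const c)
    have "(const c :: ('v, 'k) mpoly) \<in> homog 0" by (simp add: const_def homog_def mdeg_def)
    then show ?case using form_ring.const zero_mem by (auto simp: hcomp_homog)
  next
    case (form i)
    then have "y i \<in> homog 1" using assms(1) by blast
    then show ?case using form_ring.form[OF form] zero_mem by (auto simp: hcomp_homog)
  next
    case (add f g)
    then show ?case by (simp add: hcomp_add add_mem)
  next
    case (mult f g)
    have "hcomp l (f * g) = hcomp l (\<Sum>a\<in>(int \<circ> mdeg) ` Poly_Mapping.keys g. f * hcomp a g)"
      by (subst sum_hcomp[of g]) (simp add: sum_distrib_left)
    also have "\<dots> = (\<Sum>a\<in>(int \<circ> mdeg) ` Poly_Mapping.keys g. hcomp (l - a) f * hcomp a g)"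
      by (simp add: hcomp_sum hcomp_mult_homog[OF hcomp_in_homog])
    also have "\<dots> \<in> form_ring m y"
      using mult.IH by (intro sum_mem mult_mem) auto
    finally show ?case .
  qed
qed


section \<open>Coordinates on a graded free subquotient\<close>

text \<open>A graded isomorphism of \<open>N/I\<close> with a free module, read on representatives,
  so that later arguments handle polynomials instead of cosets. The order on \<open>'v\<close> makes
  the polynomial type an integral domain.\<close>

locale graded_coordinates = subring_set R
  for R :: "('v::{finite,linorder}, 'k::field) mpoly set" +
  fixes N I :: "('v, 'k) mpoly set" and d :: nat and a :: "nat \<Rightarrow> int"
    and \<phi> :: "('v, 'k) mpoly \<Rightarrow> nat \<Rightarrow> ('v, 'k) mpoly"
  assumes ideal_I: "poly_ideal I" and ideal_N: "poly_ideal N"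
    and add: "f \<in> N \<Longrightarrow> g \<in> N \<Longrightarrow> \<phi> (f + g) i = \<phi> f i + \<phi> g i"
    and scale: "r \<in> R \<Longrightarrow> f \<in> N \<Longrightarrow> \<phi> (r * f) i = r * \<phi> f i"
    and kernel: "f \<in> N \<Longrightarrow> f \<in> I \<longleftrightarrow> (\<forall>i. \<phi> f i = 0)"
    and coord_mem: "f \<in> N \<Longrightarrow> i < d \<Longrightarrow> \<phi> f i \<in> R"
    and coord_zero: "f \<in> N \<Longrightarrow> d \<le> i \<Longrightarrow> \<phi> f i = 0"
    and coord_homog: "f \<in> N \<Longrightarrow> f \<in> homog l \<Longrightarrow> i < d \<Longrightarrow> \<phi> f i \<in> homog (l - a i)"
    and basis: "i < d \<Longrightarrow> \<exists>f\<in>N \<inter> homog (a i). \<forall>j. \<phi> f j = (if j = i then 1 else 0)"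
begin

lemma coord_sum:
  assumes "\<And>j. j \<in> A \<Longrightarrow> c j \<in> R" "\<And>j. j \<in> A \<Longrightarrow> f j \<in> N"
  shows "\<phi> (\<Sum>j\<in>A. c j * f j) i = (\<Sum>j\<in>A. c j * \<phi> (f j) i)"
  using assms
proof (induction A rule: infinite_finite_induct)
  case (insert x F)
  have "(\<Sum>j\<in>F. c j * f j) \<in> N"
    using insert.prems(2) by (intro poly_ideal_sum[OF ideal_N] poly_ideal_mult[OF ideal_N]) auto
  moreover have "c x * f x \<in> N" using insert.prems(2) by (intro poly_ideal_mult[OF ideal_N]) auto
  ultimately show ?case using insert by (simp add: add scale)
qed (use scale[OF zero_mem poly_ideal_zero[OF ideal_N]] in simp_all)

text \<open>The coordinates of \<open>r * f\<close> are those of \<open>f\<close> times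
  \<open>r\<close>, and the polynomial ring is a domain.\<close>

lemma torsion_free:
  assumes "r \<in> R" "r \<noteq> 0" "f \<in> N" "r * f \<in> I"
  shows "f \<in> I"
proof -
  have "r * f \<in> N" using poly_ideal_mult[OF ideal_N assms(3)] .
  then have "\<forall>i. r * \<phi> f i = 0" using kernel assms by (simp add: scale)
  then show ?thesis using kernel assms by simp
qed

text \<open>The residues lie in the span of the first \<open>k\<close> basis elements. More than
  \<open>k\<close> coordinate vectors satisfy a linear relation, which is a relation modulo
  \<open>I\<close> because \<open>I\<close> is the kernel of the coordinates.\<close>

lemma independent_mod_le:
  assumes "\<And>j. j < n \<Longrightarrow> e j \<in> N" "\<And>j t. j < n \<Longrightarrow> k \<le> t \<Longrightarrow> \<phi> (e j) t = 0"
    and "k \<le> d" "independent_mod R I n e"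
  shows "n \<le> k"
proof (rule ccontr)
  assume "\<not> n \<le> k"
  then have lt: "k < card {..<n}" by simp
  have wR: "\<phi> (e j) t \<in> R" if "j \<in> {..<n}" "t < k" for j t
    using that assms(1,3) by (intro coord_mem) auto
  obtain c where c: "\<forall>j\<in>{..<n}. c j \<in> R" "\<exists>j\<in>{..<n}. c j \<noteq> 0"
      "\<forall>t<k. (\<Sum>j<n. c j * \<phi> (e j) t) = 0"
    using exists_linear_relation[OF subring_set_axioms finite_lessThan lt, of "\<lambda>j. \<phi> (e j)"] wR
    by blast
  have N: "(\<Sum>j<n. c j * e j) \<in> N"
    using assms(1) by (intro poly_ideal_sum[OF ideal_N] poly_ideal_mult[OF ideal_N]) auto
  have "\<phi> (\<Sum>j<n. c j * e j) t = 0" for t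
  proof (cases "t < k")
    case True
    then show ?thesis using c(1,3) assms(1) by (subst coord_sum) auto
  next
    case False
    then show ?thesis using c(1) assms(1,2) by (subst coord_sum) auto
  qed
  then have "(\<Sum>j<n. c j * e j) \<in> I" using kernel N by blast
  then show False using assms(4) c(1,2) unfolding independent_mod_def by blast
qed

lemma independent_mod_le_rank:
  assumes "\<And>j. j < n \<Longrightarrow> e j \<in> N" "independent_mod R I n e"
  shows "n \<le> d"
  using independent_mod_le[OF assms(1) _ order_refl assms(2)] coord_zero assms(1) by simp

text \<open>Take homogeneous preimages of the unit vectors. All initial segments are included
  because the degree comparison uses only the first \<open>i + 1\<close> elements.\<close>

lemma independent_basis:
  "\<exists>e. (\<forall>i<d. e i \<in> N) \<and> (\<forall>i<d. e i \<in> homog (a i)) \<and> (\<forall>n\<le>d. independent_mod R I n e)"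
proof -
  obtain e where e: "\<And>i. i < d \<Longrightarrow> e i \<in> N \<inter> homog (a i)"
      "\<And>i j. i < d \<Longrightarrow> \<phi> (e i) j = (if j = i then 1 else 0)"
    using basis by metis
  have "independent_mod R I n e" if "n \<le> d" for n
    unfolding independent_mod_def
  proof (intro allI impI)
    fix c i
    assume c: "(\<forall>j<n. c j \<in> R) \<and> (\<Sum>j<n. c j * e j) \<in> I" and i: "i < n"
    have "(\<Sum>j<n. c j * e j) \<in> N"
      using e(1) that by (intro poly_ideal_sum[OF ideal_N] poly_ideal_mult[OF ideal_N]) auto
    then have "\<phi> (\<Sum>j<n. c j * e j) i = 0" using kernel c by blast
    moreover have "\<phi> (\<Sum>j<n. c j * e j) i = (\<Sum>j<n. c j * \<phi> (e j) i)"
      using c e(1) that by (intro coord_sum) auto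
    moreover have "\<dots> = (\<Sum>j<n. if j = i then c j else 0)"
      using e(2) that by (intro sum.cong) auto
    ultimately show "c i = 0" using i by simp
  qed
  with e(1) show ?thesis by blast
qed

end

text \<open>Compose the isomorphism with the residue map. Injectivity identifies the kernel with
  \<open>I\<close>; surjectivity on graded pieces gives homogeneous preimages of the unit
  vectors.\<close>

lemma graded_iso_coordinates:
  assumes iso: "graded_iso R (gquot (*) homog N I) (gfree R d a)"
    and R: "subring_set R" and N: "poly_ideal N" and I: "poly_ideal I" and "I \<subseteq> N"
  obtains \<phi> where "graded_coordinates R N I d a \<phi>"
proof -
  interpret subring_set R by (rule R)
  let ?M = "gquot (*) homog N I" and ?G = "gfree R d a"
  obtain \<Phi> where hom: "graded_hom R ?M ?G \<Phi>" and bij: "bij_betw \<Phi> (gcarrier ?M) (gcarrier ?G)"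
    and piece: "\<And>l. \<Phi> ` gpiece ?M l = gpiece ?G l"
    using iso by (auto simp: graded_iso_def)
  define \<phi> where "\<phi> f = \<Phi> (f +o I)" for f
  have M: "f +o I \<in> gcarrier ?M" if "f \<in> N" for f
    using that by (simp add: gquot_def)
  have \<phi>G: "\<phi> f \<in> gcarrier ?G" if "f \<in> N" for f
    using hom M[OF that] by (simp add: graded_hom_def \<phi>_def)
  have \<phi>_add: "\<phi> (f + g) = (\<lambda>i. \<phi> f i + \<phi> g i)" if "f \<in> N" "g \<in> N" for f g
  proof -
    have "\<Phi> (gadd ?M (f +o I) (g +o I)) = gadd ?G (\<phi> f) (\<phi> g)"
      using hom M that by (simp add: graded_hom_def \<phi>_def)
    then show ?thesis by (simp add: gquot_def gfree_def coset_add[OF I] \<phi>_def)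
  qed
  have \<phi>_scale: "\<phi> (r * f) = (\<lambda>i. r * \<phi> f i)" if "r \<in> R" "f \<in> N" for r f
  proof -
    have "\<Phi> (gsmult ?M r (f +o I)) = gsmult ?G r (\<phi> f)"
      using hom M that by (simp add: graded_hom_def \<phi>_def)
    then show ?thesis by (simp add: gquot_def gfree_def coset_mult[OF I] \<phi>_def)
  qed
  have \<phi>0: "\<phi> 0 = (\<lambda>_. 0)"
    using \<phi>_scale[OF zero_mem poly_ideal_zero[OF N]] by simp
  have "f \<in> I \<longleftrightarrow> (\<forall>i. \<phi> f i = 0)" if "f \<in> N" for f
  proof -
    have "f \<in> I \<longleftrightarrow> f +o I = 0 +o I" using coset_eq_iff[OF I, of f 0] by simp
    also have "\<dots> \<longleftrightarrow> \<phi> f = \<phi> 0"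
      using bij M that poly_ideal_zero[OF N] unfolding \<phi>_def bij_betw_def inj_on_def by metis
    finally show ?thesis by (auto simp: \<phi>0)
  qed
  moreover have "\<phi> f i \<in> homog (l - a i)" if "f \<in> N" "f \<in> homog l" "i < d" for f l i
  proof -
    have "f +o I \<in> gpiece ?M l" using that by (simp add: gquot_def)
    then have "\<phi> f \<in> gpiece ?G l" using piece by (auto simp: \<phi>_def)
    then show ?thesis using that by (simp add: gfree_def)
  qed
  moreover have "\<exists>f\<in>N \<inter> homog (a i). \<forall>j. \<phi> f j = (if j = i then 1 else 0)" if "i < d" for i
  proof -
    \<comment> \<open>The entry 1 has degree \<open>a i - a i = 0\<close>, and the entries 0 lie in
      every degree.\<close>
    have "(\<lambda>j. if j = i then 1 else 0) \<in> gpiece ?G (a i)"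
      using that one_mem zero_mem by (auto simp: gfree_def homog_def mdeg_def)
    then obtain U where U: "U \<in> gpiece ?M (a i)" "\<Phi> U = (\<lambda>j. if j = i then 1 else 0)"
      using piece by (metis (no_types, lifting) imageE)
    then obtain f where "f \<in> N \<inter> homog (a i)" "U = f +o I" by (auto simp: gquot_def)
    with U(2) show ?thesis by (intro bexI[of _ f]) (simp_all add: \<phi>_def)
  qed
  moreover have "\<phi> f i \<in> R" if "f \<in> N" "i < d" for f i
    using \<phi>G[OF that(1)] that(2) by (simp add: gfree_def)
  moreover have "\<phi> f i = 0" if "f \<in> N" "d \<le> i" for f i
    using \<phi>G[OF that(1)] that(2) by (simp add: gfree_def)
  ultimately have "graded_coordinates R N I d a \<phi>"
    using N I \<phi>_add \<phi>_scale by unfold_locales auto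
  then show thesis by (rule that)
qed

text \<open>The annihilators are closed under division by nonzero scalars of \<open>R\<close>, so an annihilator of
  maximal rank is maximal; this replaces the ascending chain condition.\<close>

lemma (in graded_coordinates) nonzerodivisor_if_not_in_associated_primes:
  assumes N: "N = UNIV" and F: "\<forall>P\<in>associated_primes I. F \<notin> P" and "F * g \<in> I"
  shows "g \<in> I"
proof (rule ccontr)
  assume "g \<notin> I"
  \<comment> \<open>\<open>Q r\<close>: some nonzero residue \<open>b\<close> killed by
    \<open>F\<close> has an annihilator of rank at least \<open>r\<close>. The rank of $A_n/I$
    bounds \<open>r\<close>, so a maximal \<open>r\<close> exists.\<close>
  define Q where "Q r \<longleftrightarrow> (\<exists>b e. b \<notin> I \<and> F * b \<in> I \<and> (\<forall>j<r. e j * b \<in> I) \<and>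
    independent_mod R I r e)" for r
  have "Q 0"
    unfolding Q_def using \<open>g \<notin> I\<close> \<open>F * g \<in> I\<close> by (auto simp: independent_mod_def)
  moreover have bound: "Q r \<Longrightarrow> r \<le> d" for r
    unfolding Q_def using independent_mod_le_rank N by blast
  ultimately obtain r where "Q r" and max: "\<And>r'. Q r' \<Longrightarrow> r' \<le> r"
    using GreatestI_nat[of Q 0 d] Greatest_le_nat[of Q _ d] by blast
  then obtain b e where b: "b \<notin> I" "F * b \<in> I" and e: "\<forall>j<r. e j * b \<in> I"
    and ind: "independent_mod R I r e" unfolding Q_def by blast
  have maximal: "h * b \<in> I" if g: "g * b \<notin> I" and h: "h * (g * b) \<in> I" for g h
  proof -
    \<comment> \<open>Since \<open>g * b\<close> is again nonzero modulo \<open>I\<close> and killed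
      by \<open>F\<close> and all \<open>e j\<close>, independence of \<open>e\<close> extended by
      \<open>h\<close> would contradict the maximality of \<open>r\<close>.\<close>
    define e' where "e' j = (if j = r then h else e j)" for j
    have swap: "f * (g * b) \<in> I" if "f * b \<in> I" for f
      using poly_ideal_mult[OF ideal_I that, of g] by (simp add: mult.left_commute)
    have "F * (g * b) \<in> I" "\<forall>j<Suc r. e' j * (g * b) \<in> I"
      using swap b(2) e h by (auto simp: e'_def less_Suc_eq)
    then have "\<not> independent_mod R I (Suc r) e'"
      using g max[of "Suc r"] unfolding Q_def by (meson Suc_n_not_le_n)
    then obtain c where c: "\<forall>j<Suc r. c j \<in> R" "(\<Sum>j<Suc r. c j * e' j) \<in> I"
        "\<exists>j<Suc r. c j \<noteq> 0" unfolding independent_mod_def by blast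
    have sum: "(\<Sum>j<Suc r. c j * e' j) = (\<Sum>j<r. c j * e j) + c r * h"
      by (simp add: e'_def)
    have "c r \<noteq> 0"
    proof
      assume "c r = 0"
      then have "(\<Sum>j<r. c j * e j) \<in> I" using c(2) sum by simp
      then have "\<forall>j<r. c j = 0" using c(1) ind unfolding independent_mod_def by auto
      then show False using c(3) \<open>c r = 0\<close> by (auto simp: less_Suc_eq)
    qed
    have "(\<Sum>j<r. c j * e j) * b \<in> I"
      unfolding sum_distrib_right mult.assoc
      using poly_ideal_mult[OF ideal_I] e by (intro poly_ideal_sum[OF ideal_I]) auto
    moreover have "((\<Sum>j<r. c j * e j) + c r * h) * b \<in> I"
      using poly_ideal_mult[OF ideal_I c(2), of b] unfolding sum by (simp add: mult.commute)
    ultimately have "((\<Sum>j<r. c j * e j) + c r * h) * b - (\<Sum>j<r. c j * e j) * b \<in> I"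
      using poly_ideal_diff[OF ideal_I] by blast
    \<comment> \<open>Only the term with \<open>h\<close> remains; torsion-freeness cancels its
      nonzero coefficient \<open>c r\<close>.\<close>
    then have "c r * (h * b) \<in> I" by (simp add: distrib_right mult.assoc)
    then show ?thesis using torsion_free[of "c r" "h * b"] c(1) \<open>c r \<noteq> 0\<close> N by simp
  qed
  \<comment> \<open>The annihilator of \<open>b\<close> contains \<open>F\<close>, so its primality
    contradicts the assumption on \<open>F\<close>.\<close>
  have "prime_poly_ideal {g. g * b \<in> I}"
    unfolding prime_poly_ideal_def
  proof (intro conjI allI impI)
    show "poly_ideal {g. g * b \<in> I}"
      using ideal_I by (auto simp: poly_ideal_iff distrib_right mult.assoc)
    have "1 \<notin> {g. g * b \<in> I}" using b(1) by simp
    then show "{g. g * b \<in> I} \<noteq> UNIV" by blast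
  next
    fix f g assume "f * g \<in> {g. g * b \<in> I}"
    then show "f \<in> {g. g * b \<in> I} \<or> g \<in> {g. g * b \<in> I}"
      using maximal[of g f] by (auto simp: mult.assoc)
  qed
  then have "{g. g * b \<in> I} \<in> associated_primes I" unfolding associated_primes_def by blast
  with F have "F \<notin> {g. g * b \<in> I}" by (rule bspec)
  then show False using b(2) by simp
qed

text \<open>\<open>P\<close> is the annihilator of some residue, nonzero because \<open>P\<close> is
  proper, and a nonzero scalar of \<open>R\<close> kills no such residue.\<close>

lemma (in graded_coordinates) not_in_associated_prime:
  assumes "N = UNIV" "r \<in> R" "r \<noteq> 0" "P \<in> associated_primes I"
  shows "r \<notin> P"
proof
  assume "r \<in> P"
  obtain b where P: "P = {g. g * b \<in> I}" "P \<noteq> UNIV"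
    using assms(4) by (auto simp: associated_primes_def prime_poly_ideal_def)
  then have "b \<in> I" using \<open>r \<in> P\<close> torsion_free[of r b] assms by simp
  then show False using P poly_ideal_mult[OF ideal_I] by auto
qed


section \<open>Comparison of the two sequences\<close>

lemma relative_ideal_meets_subring:
  assumes X: "graded_coordinates R UNIV I d a \<phi>" and Y: "graded_coordinates R J I d b \<psi>"
    and "I \<subseteq> J"
  obtains r where "r \<in> R" "r \<noteq> 0" "r \<in> J"
proof -
  interpret X: graded_coordinates R UNIV I d a \<phi> by (rule X)
  interpret Y: graded_coordinates R J I d b \<psi> by (rule Y)
  obtain e where e: "\<forall>i<d. e i \<in> J" and "\<forall>n\<le>d. independent_mod R I n e"
    using Y.independent_basis by blast
  then have ind: "independent_mod R I d e" by simp
  \<comment> \<open>Together with 1, the basis of $I_Y/I_X$ gives \<open>d + 1\<close> residues in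
    $A_X$, which has rank \<open>d\<close>. In the resulting relation the coefficient of 1 is
    nonzero and lies in \<open>J\<close>.\<close>
  define e' where "e' j = (if j = d then 1 else e j)" for j
  have "\<not> independent_mod R I (Suc d) e'"
    using X.independent_mod_le_rank[of "Suc d" e'] by auto
  then obtain c where c: "\<forall>j<Suc d. c j \<in> R" "(\<Sum>j<Suc d. c j * e' j) \<in> I"
      "\<exists>j<Suc d. c j \<noteq> 0" unfolding independent_mod_def by blast
  have sum: "(\<Sum>j<Suc d. c j * e' j) = (\<Sum>j<d. c j * e j) + c d"
    by (simp add: e'_def)
  have "c d \<noteq> 0"
  proof
    assume "c d = 0"
    then have "(\<Sum>j<d. c j * e j) \<in> I" using c(2) sum by simp
    then have "\<forall>j<d. c j = 0" using c(1) ind unfolding independent_mod_def by auto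
    then show False using c(3) \<open>c d = 0\<close> by (auto simp: less_Suc_eq)
  qed
  moreover have "(\<Sum>j<d. c j * e j) \<in> J"
    using e by (intro poly_ideal_sum[OF Y.ideal_N] poly_ideal_mult[OF Y.ideal_N]) auto
  then have "c d \<in> J"
    using poly_ideal_diff[OF Y.ideal_N, of "(\<Sum>j<d. c j * e j) + c d" "\<Sum>j<d. c j * e j"]
      c(2) sum \<open>I \<subseteq> J\<close> by auto
  ultimately show thesis using that c(1) by blast
qed

lemma shifted_basis_degree_le:
  assumes X: "graded_coordinates R UNIV I d a \<phi>" and Y: "graded_coordinates R J I d b \<psi>"
    and mono: "mono_on {..<d} a" "mono_on {..<d} b"
    and F: "F \<in> J" "F \<in> homog s" and nzd: "\<And>g. F * g \<in> I \<Longrightarrow> g \<in> I" and "i < d"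
  shows "b i \<le> s + a i"
proof (rule ccontr)
  assume less: "\<not> b i \<le> s + a i"
  interpret X: graded_coordinates R UNIV I d a \<phi> by (rule X)
  interpret Y: graded_coordinates R J I d b \<psi> by (rule Y)
  obtain e where e: "\<forall>i<d. e i \<in> homog (a i)"
    and ind: "\<forall>n\<le>d. independent_mod R I n e"
    using X.independent_basis by blast
  have FJ: "F * e j \<in> J" for j
    using poly_ideal_mult[OF Y.ideal_N F(1), of "e j"] by (simp add: mult.commute)
  \<comment> \<open>Coordinate \<open>t\<close> has degree \<open>s + a j - b t\<close>, at most
    \<open>s + a i - b i\<close> by monotonicity, hence negative.\<close>
  have "\<psi> (F * e j) t = 0" if "j < Suc i" "i \<le> t" for j t
  proof (cases "t < d")
    case True
    have "F * e j \<in> homog (s + a j)" using homog_mult[OF F(2)] e that \<open>i < d\<close> by simp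
    then have "\<psi> (F * e j) t \<in> homog (s + a j - b t)" using Y.coord_homog FJ True by blast
    moreover have "a j \<le> a i" "b i \<le> b t"
      using that True \<open>i < d\<close> by (auto intro: mono_onD[OF mono(1)] mono_onD[OF mono(2)])
    ultimately show ?thesis using homog_negative less by force
  qed (use Y.coord_zero FJ in simp)
  \<comment> \<open>Factor \<open>F\<close> out of a relation and cancel it as a
    nonzerodivisor.\<close>
  moreover have "independent_mod R I (Suc i) (\<lambda>j. F * e j)"
    unfolding independent_mod_def
  proof (intro allI impI)
    fix c j
    assume c: "(\<forall>j<Suc i. c j \<in> R) \<and> (\<Sum>j<Suc i. c j * (F * e j)) \<in> I" and j: "j < Suc i"
    have "(\<Sum>j<Suc i. c j * (F * e j)) = F * (\<Sum>j<Suc i. c j * e j)"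
      unfolding sum_distrib_left by (simp add: mult.left_commute)
    then have "(\<Sum>j<Suc i. c j * e j) \<in> I" using c nzd by metis
    then show "c j = 0"
      using c j ind[rule_format, of "Suc i"] \<open>i < d\<close> unfolding independent_mod_def by auto
  qed
  ultimately have "Suc i \<le> i"
    using FJ \<open>i < d\<close> by (intro Y.independent_mod_le[of "Suc i" "\<lambda>j. F * e j"]) auto
  then show False by simp
qed

theorem mainTheorem9:
  fixes I\<^sub>X I\<^sub>Y :: "('v::{finite,linorder}, 'k::{alg_closed_field,field_char_0}) mpoly set"
    and y :: "nat \<Rightarrow> ('v, 'k) mpoly"
    and m d s :: nat
    and ms ns :: "nat \<Rightarrow> nat"
  assumes "projective_subscheme I\<^sub>X"
    and "gorenstein I\<^sub>X"
    and "pure_dim I\<^sub>X m"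
    and "m \<ge> 1"
    and "has_degree I\<^sub>X m d"
    and "avoiding_forms I\<^sub>X m y"
    and "characteristic_sequence I\<^sub>X m y d ms"
    and "acm_hypersurface I\<^sub>X m I\<^sub>Y"
    and "relative_characteristic_sequence I\<^sub>X I\<^sub>Y m y d ns"
    and "s = smallest_hypersurface_degree I\<^sub>X I\<^sub>Y"
  shows "(\<forall>i<d. ns i \<le> s + ms i) \<and>
    (prime_poly_ideal I\<^sub>X \<longrightarrow> (\<forall>i<d. ns i \<le> ns 0 + ms i))"
proof -
  let ?R = "form_ring m y"
  have I: "poly_ideal I\<^sub>X"
    using assms(1) by (simp add: projective_subscheme_def homogeneous_ideal_def)
  have J: "homogeneous_ideal I\<^sub>Y" "poly_ideal I\<^sub>Y" "I\<^sub>X \<subseteq> I\<^sub>Y"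
    using assms(8)
    by (auto simp: acm_hypersurface_def projective_subscheme_def homogeneous_ideal_def)
  have "graded_iso ?R (gquot (*) homog UNIV I\<^sub>X) (gfree ?R d (\<lambda>i. int (ms i)))"
    using assms(7) by (simp add: characteristic_sequence_def coord_ring_def)
  moreover have "poly_ideal (UNIV :: ('v, 'k) mpoly set)" by (simp add: poly_ideal_iff)
  ultimately obtain \<phi> where X: "graded_coordinates ?R UNIV I\<^sub>X d (\<lambda>i. int (ms i)) \<phi>"
    by (rule graded_iso_coordinates[OF _ subring_set_form_ring _ I subset_UNIV])
  have "graded_iso ?R (gquot (*) homog I\<^sub>Y I\<^sub>X) (gfree ?R d (\<lambda>i. int (ns i)))"
    using assms(9) by (simp add: relative_characteristic_sequence_def relative_ideal_def)
  then obtain \<psi> where Y: "graded_coordinates ?R I\<^sub>Y I\<^sub>X d (\<lambda>i. int (ns i)) \<psi>"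
    by (rule graded_iso_coordinates[OF _ subring_set_form_ring J(2) I J(3)])
  interpret X: graded_coordinates ?R UNIV I\<^sub>X d "\<lambda>i. int (ms i)" \<phi> by (rule X)
  interpret Y: graded_coordinates ?R I\<^sub>Y I\<^sub>X d "\<lambda>i. int (ns i)" \<psi> by (rule Y)
  define S where "S t \<longleftrightarrow> (\<exists>F\<in>homog (int t). F \<noteq> 0 \<and> F \<in> I\<^sub>Y \<and> (\<forall>P\<in>associated_primes I\<^sub>X. F \<notin> P))"
    for t
  have s: "s = (LEAST t. S t)"
    using assms(10) by (simp add: smallest_hypersurface_degree_def S_def)
  \<comment> \<open>\<open>LEAST\<close> is meaningful only once some degree satisfies
    \<open>S\<close>; a nonzero component of an element of $I_Y$ in $R_m$ provides one.\<close>
  obtain r l where r: "hcomp l r \<noteq> 0" "r \<in> ?R" "r \<in> I\<^sub>Y"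
    using relative_ideal_meets_subring[OF X Y J(3)] hcomp_nonzero by metis
  have "hcomp l r \<in> ?R"
    using r(2) assms(6) form_ring_hcomp by (auto simp: avoiding_forms_def)
  then have "\<forall>P\<in>associated_primes I\<^sub>X. hcomp l r \<notin> P"
    using X.not_in_associated_prime r(1) by blast
  moreover have "0 \<le> l" using homog_negative[OF hcomp_in_homog] r(1) by (metis not_le)
  then have "hcomp l r \<in> homog (int (nat l))" using hcomp_in_homog[of l r] by simp
  ultimately have "S (nat l)"
    unfolding S_def using r(1) homogeneous_ideal_hcomp[OF J(1) r(3)] by blast
  then have "S s" unfolding s by (rule LeastI)
  then obtain F where F: "F \<in> homog (int s)" "F \<in> I\<^sub>Y" "\<forall>P\<in>associated_primes I\<^sub>X. F \<notin> P"
    unfolding S_def by blast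
  have bound: "ns i \<le> s + ms i" if "i < d" for i
  proof -
    have "mono_on {..<d} (\<lambda>i. int (ms i))" "mono_on {..<d} (\<lambda>i. int (ns i))"
      using assms(7,9)
      by (auto simp: characteristic_sequence_def relative_characteristic_sequence_def mono_on_def)
    then have "int (ns i) \<le> int s + int (ms i)"
      using shifted_basis_degree_le[OF X Y _ _ F(2,1) _ that]
        X.nonzerodivisor_if_not_in_associated_primes[OF refl F(3)] by blast
    then show ?thesis by linarith
  qed
  moreover have "ns i \<le> ns 0 + ms i" if prime: "prime_poly_ideal I\<^sub>X" and "i < d" for i
  proof -
    have "0 < d" using that(2) by simp
    \<comment> \<open>The first basis element of $I_Y/I_X$ has degree $n_0$ and nonzero residue in
      $A_X$; showing that it avoids every component gives \<open>S (ns 0)\<close>, hence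
      \<open>s \<le> ns 0\<close>.\<close>
    then obtain f where f: "f \<in> I\<^sub>Y" "f \<in> homog (int (ns 0))"
        "\<forall>j. \<psi> f j = (if j = 0 then 1 else 0)"
      using Y.basis[of 0] by blast
    have "\<psi> f 0 \<noteq> 0" using f(3) by simp
    then have "f \<notin> I\<^sub>X" using Y.kernel[OF f(1)] by blast
    moreover have "f \<notin> P" if assoc: "P \<in> associated_primes I\<^sub>X" for P
    proof -
      obtain b where P: "P = {g. g * b \<in> I\<^sub>X}" "P \<noteq> UNIV"
        using assoc by (auto simp: associated_primes_def prime_poly_ideal_def)
      then have "b \<notin> I\<^sub>X" using poly_ideal_mult[OF I] by blast
      \<comment> \<open>If \<open>f\<close> were in \<open>P\<close>, then \<open>f * b\<close>
        would lie in the prime ideal \<open>I\<^sub>X\<close>, which contains neither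
        factor.\<close>
      then show ?thesis using P \<open>f \<notin> I\<^sub>X\<close> prime by (auto simp: prime_poly_ideal_def)
    qed
    moreover have "f \<noteq> 0" using \<open>f \<notin> I\<^sub>X\<close> poly_ideal_zero[OF I] by metis
    ultimately have "S (ns 0)"
      unfolding S_def using f(1,2) by (intro bexI[of _ f]) simp_all
    then have "s \<le> ns 0" unfolding s by (rule Least_le)
    then show ?thesis using bound[OF that(2)] by linarith
  qed
  ultimately show ?thesis by blast
qed

end
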